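(* Let $G$ be a group, $R$ a $G$-graded ring and $n$ a natural number. Then $R$ is graded nil clean if and only if the graded triangular matrix ring $T_n(R)(\overline{\sigma})$ is graded nil clean for every $\overline{\sigma}\in G^n$. Likewise, $R$ is graded strongly nil clean if and only if $T_n(R)(\overline{\sigma})$ is graded strongly nil clean for every $\overline{\sigma}\in G^n$.
   Context: All rings are associative with identity. A ring $R$ is $G$-graded if $R=\bigoplus_{g\in G}R_g$ with additive subgroups $R_g$ satisfying $R_gR_h\subseteq R_{gh}$ for all $g,h\in G$; elements of $\bigcup_{g\in G}R_g$ are called homogeneous. A homogeneous element is graded nil clean if it is the sum of a homogeneous idempotent $f$ and a homogeneous nilpotent $b$; it is graded strongly nil clean if $f,b$ can be chosen with moreover $fb=bf$. A $G$-graded ring is graded (strongly) nil clean if every one of its homogeneous elements is graded (strongly) nil clean. For $\overline{\sigma}=(g_1,\dots,g_n)\in G^n$, the matrix ring $M_n(R)$ is $G$-graded, with component of degree $\lambda\in G$ given by $M_n(R)_\lambda(\overline{\sigma})=\{(a_{ij}) : a_{ij}\in R_{g_i\lambda g_j^{-1}}\text{ for all }i,j\}$; this graded ring is denoted $M_n(R)(\overline{\sigma})$. $T_n(R)(\overline{\sigma})$ denotes the ring of upper triangular $n\times n$ matrices over $R$ with the grading inherited from $M_n(R)(\overline{\sigma})$, i.e. its component of degree $\lambda$ consists of the upper triangular matrices in $M_n(R)_\lambda(\overline{\sigma})$. *)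

theory Defs
  imports "HOL-Algebra.AbelCoset" "Jordan_Normal_Form.Matrix"
begin

locale graded_ring = G: group G + R: ring R
  for G :: "('g, 'm) monoid_scheme" (structure) and R :: "('r, 'k) ring_scheme" (structure)
    and A :: "'g \<Rightarrow> 'r set" +
  assumes component_additive_subgroup: "g \<in> carrier G \<Longrightarrow> additive_subgroup (A g) R"
    and direct_sum: "x \<in> carrier R \<Longrightarrow>
      \<exists>!c. c \<in> (\<Pi>\<^sub>E g\<in>carrier G. A g) \<and> finite {g \<in> carrier G. c g \<noteq> \<zero>\<^bsub>R\<^esub>} \<and>
        x = (\<Oplus>\<^bsub>R\<^esub>g\<in>{g \<in> carrier G. c g \<noteq> \<zero>\<^bsub>R\<^esub>}. c g)"
    and component_mult: "\<lbrakk>g \<in> carrier G; h \<in> carrier G; x \<in> A g; y \<in> A h\<rbrakk>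
      \<Longrightarrow> x \<otimes>\<^bsub>R\<^esub> y \<in> A (g \<otimes>\<^bsub>G\<^esub> h)"

definition homogeneous :: "('g, 'm) monoid_scheme \<Rightarrow> ('g \<Rightarrow> 'r set) \<Rightarrow> 'r set" where
  "homogeneous G A = (\<Union>g\<in>carrier G. A g)"

definition idempotent :: "('r, 'k) ring_scheme \<Rightarrow> 'r \<Rightarrow> bool" where
  "idempotent R f \<longleftrightarrow> f \<in> carrier R \<and> f \<otimes>\<^bsub>R\<^esub> f = f"

definition nilpotent :: "('r, 'k) ring_scheme \<Rightarrow> 'r \<Rightarrow> bool" where
  "nilpotent R b \<longleftrightarrow> b \<in> carrier R \<and> (\<exists>k::nat. b [^]\<^bsub>R\<^esub> k = \<zero>\<^bsub>R\<^esub>)"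

text \<open>The idempotent and the nilpotent are required to be homogeneous, but not of the same degree as
  the element they decompose.\<close>

definition graded_nil_clean_elem ::
  "('g, 'm) monoid_scheme \<Rightarrow> ('r, 'k) ring_scheme \<Rightarrow> ('g \<Rightarrow> 'r set) \<Rightarrow> 'r \<Rightarrow> bool" where
  "graded_nil_clean_elem G R A x \<longleftrightarrow>
    (\<exists>f\<in>homogeneous G A. \<exists>b\<in>homogeneous G A.
      idempotent R f \<and> nilpotent R b \<and> x = f \<oplus>\<^bsub>R\<^esub> b)"

definition graded_strongly_nil_clean_elem ::
  "('g, 'm) monoid_scheme \<Rightarrow> ('r, 'k) ring_scheme \<Rightarrow> ('g \<Rightarrow> 'r set) \<Rightarrow> 'r \<Rightarrow> bool" where
  "graded_strongly_nil_clean_elem G R A x \<longleftrightarrow>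
    (\<exists>f\<in>homogeneous G A. \<exists>b\<in>homogeneous G A.
      idempotent R f \<and> nilpotent R b \<and> x = f \<oplus>\<^bsub>R\<^esub> b \<and> f \<otimes>\<^bsub>R\<^esub> b = b \<otimes>\<^bsub>R\<^esub> f)"

definition graded_nil_clean ::
  "('g, 'm) monoid_scheme \<Rightarrow> ('r, 'k) ring_scheme \<Rightarrow> ('g \<Rightarrow> 'r set) \<Rightarrow> bool" where
  "graded_nil_clean G R A \<longleftrightarrow> (\<forall>x\<in>homogeneous G A. graded_nil_clean_elem G R A x)"

definition graded_strongly_nil_clean ::
  "('g, 'm) monoid_scheme \<Rightarrow> ('r, 'k) ring_scheme \<Rightarrow> ('g \<Rightarrow> 'r set) \<Rightarrow> bool" where
  "graded_strongly_nil_clean G R A \<longleftrightarrow>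
    (\<forall>x\<in>homogeneous G A. graded_strongly_nil_clean_elem G R A x)"

text \<open>Matrices are 0-indexed. The matrix operations of \<open>Jordan_Normal_Form\<close> are tied to type-class
  rings, so only its matrix type is used; the ring structure comes from the record \<open>R\<close>.\<close>

definition matrix_ring :: "('r, 'k) ring_scheme \<Rightarrow> nat \<Rightarrow> 'r mat ring" where
  "matrix_ring R n =
    \<lparr>carrier = {M \<in> carrier_mat n n. \<forall>i<n. \<forall>j<n. M $$ (i, j) \<in> carrier R},
     monoid.mult = (\<lambda>M N. mat n n (\<lambda>(i, j). \<Oplus>\<^bsub>R\<^esub>k\<in>{..<n}. M $$ (i, k) \<otimes>\<^bsub>R\<^esub> N $$ (k, j))),
     one = mat n n (\<lambda>(i, j). if i = j then \<one>\<^bsub>R\<^esub> else \<zero>\<^bsub>R\<^esub>),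
     zero = mat n n (\<lambda>_. \<zero>\<^bsub>R\<^esub>),
     add = (\<lambda>M N. mat n n (\<lambda>(i, j). M $$ (i, j) \<oplus>\<^bsub>R\<^esub> N $$ (i, j)))\<rparr>"

definition triangular_ring :: "('r, 'k) ring_scheme \<Rightarrow> nat \<Rightarrow> 'r mat ring" where
  "triangular_ring R n = (matrix_ring R n)
    \<lparr>carrier := {M \<in> carrier (matrix_ring R n). \<forall>i<n. \<forall>j<i. M $$ (i, j) = \<zero>\<^bsub>R\<^esub>}\<rparr>"

definition matrix_component :: "('g, 'm) monoid_scheme \<Rightarrow> ('r, 'k) ring_scheme \<Rightarrow> ('g \<Rightarrow> 'r set) \<Rightarrow>
    nat \<Rightarrow> (nat \<Rightarrow> 'g) \<Rightarrow> 'g \<Rightarrow> 'r mat set" where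
  "matrix_component G R A n \<sigma> d = {M \<in> carrier (matrix_ring R n).
    \<forall>i<n. \<forall>j<n. M $$ (i, j) \<in> A (\<sigma> i \<otimes>\<^bsub>G\<^esub> d \<otimes>\<^bsub>G\<^esub> inv\<^bsub>G\<^esub> (\<sigma> j))}"

definition triangular_component :: "('g, 'm) monoid_scheme \<Rightarrow> ('r, 'k) ring_scheme \<Rightarrow>
    ('g \<Rightarrow> 'r set) \<Rightarrow> nat \<Rightarrow> (nat \<Rightarrow> 'g) \<Rightarrow> 'g \<Rightarrow> 'r mat set" where
  "triangular_component G R A n \<sigma> d =
    matrix_component G R A n \<sigma> d \<inter> carrier (triangular_ring R n)"

end

theory Submission
  imports Defs "HOL-Algebra.Subrings"
begin

text \<open>Three observations prove both equivalences.

  First, degrees are rigid. A nonzero homogeneous idempotent has degree \<open>h\<close> with \<open>h h = h\<close>, hence unit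
  degree (\<open>idempotent_degree\<close>). If a homogeneous \<open>x\<close> of degree other than the unit is a homogeneous
  idempotent plus a homogeneous nilpotent, then comparing components shows that \<open>x\<close> is that nilpotent
  or zero (\<open>nilpotent_off_unit_degree\<close>). So in a graded nil clean ring everything interesting happens
  in the unit component.

  Second, an upper triangular matrix is nilpotent exactly when its diagonal entries are
  (\<open>nilpotent_triangular_iff\<close>), and the diagonal entries of a homogeneous matrix of degree \<open>d\<close> have
  degrees conjugate to \<open>d\<close>. For \<open>R\<close> graded nil clean, a homogeneous triangular matrix \<open>M\<close> of degree
  other than the unit is therefore nilpotent. If \<open>M\<close> has unit degree, decompose each diagonal entry as
  \<open>f\<^sub>i + b\<^sub>i\<close>; the \<open>f\<^sub>i\<close> lie in the unit component, and \<open>M\<close> is the diagonal idempotent with entries \<open>f\<^sub>i\<close>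
  plus a triangular matrix whose diagonal consists of the nilpotents \<open>b\<^sub>i\<close>.

  Third, that diagonal idempotent need not commute with \<open>M\<close>, so the strong version uses an intrinsic
  criterion: \<open>x\<close> is an idempotent plus a commuting nilpotent exactly when \<open>x (1 - x)\<close> is nilpotent.
  The forward direction is a computation (\<open>nilpotent_if_idempotent_plus_nilpotent\<close>). In the backward
  direction the idempotent can be chosen as \<open>x\<close> times a polynomial in \<open>x\<close>, so it commutes with \<open>x\<close> and
  stays in any additive subgroup that contains \<open>x\<close> and is closed under multiplication
  (\<open>strongly_nil_clean_within\<close>). The criterion passes from the diagonal of \<open>M\<close> to \<open>M\<close> because
  \<open>M (1 - M)\<close> is triangular with diagonal entries \<open>x (1 - x)\<close>.

  For the converse implications the constant family of degrees \<open>\<one>\<close> is enough: with it a matrix and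
  its entries have the same degree, and the map to the upper left corner is a ring homomorphism on
  triangular matrices, so it carries a decomposition of a matrix with corner entry \<open>x\<close> to one of \<open>x\<close>.\<close>

section \<open>Commuting sums of an idempotent and a nilpotent\<close>

text \<open>Multiplying a relation \<open>u p + b q = 1\<close> by \<open>a + b = 1\<close>, and more generally two such relations with
  each other, raises the exponents one at a time; no binomial expansion is needed.\<close>

lemma (in cring) comaximal_power:
  assumes "a \<in> carrier R" "b \<in> carrier R" "a \<oplus> b = \<one>"
  shows "\<exists>p\<in>carrier R. \<exists>q\<in>carrier R. a [^] (i::nat) \<otimes> p \<oplus> b [^] (j::nat) \<otimes> q = \<one>"
proof -
  have left: "\<exists>p\<in>carrier R. \<exists>q\<in>carrier R. a [^] (i::nat) \<otimes> p \<oplus> b \<otimes> q = \<one>"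
  proof (induction i)
    case 0
    show ?case
      using assms by (intro bexI[of _ \<one>] bexI[of _ \<zero>]) auto
  next
    case (Suc i)
    then obtain p q where pq: "p \<in> carrier R" "q \<in> carrier R" "a [^] i \<otimes> p \<oplus> b \<otimes> q = \<one>"
      by blast
    define u where "u = a [^] i"
    have u: "u \<in> carrier R" using assms by (simp add: u_def)
    have "(u \<otimes> a) \<otimes> p \<oplus> b \<otimes> (u \<otimes> p \<oplus> q) = (u \<otimes> p) \<otimes> (a \<oplus> b) \<oplus> b \<otimes> q"
      using assms(1,2) pq(1,2) u by algebra
    also have "\<dots> = \<one>"
      using assms pq u by (simp add: u_def)
    finally have "a [^] Suc i \<otimes> p \<oplus> b \<otimes> (u \<otimes> p \<oplus> q) = \<one>"
      by (simp add: u_def)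
    then show ?case
      using assms pq u by blast
  qed
  show ?thesis
  proof (induction j)
    case 0
    show ?case
      using assms by (intro bexI[of _ \<zero>] bexI[of _ \<one>]) auto
  next
    case (Suc j)
    then obtain p q where pq: "p \<in> carrier R" "q \<in> carrier R"
      "a [^] i \<otimes> p \<oplus> b [^] j \<otimes> q = \<one>"
      by blast
    obtain p' q' where pq': "p' \<in> carrier R" "q' \<in> carrier R" "a [^] i \<otimes> p' \<oplus> b \<otimes> q' = \<one>"
      using left by blast
    define u v where "u = a [^] i" and "v = b [^] j"
    have u: "u \<in> carrier R" and v: "v \<in> carrier R"
      using assms by (simp_all add: u_def v_def)
    have "u \<otimes> (p \<oplus> v \<otimes> q \<otimes> p') \<oplus> (v \<otimes> b) \<otimes> (q \<otimes> q')
        = u \<otimes> p \<oplus> v \<otimes> q \<otimes> (u \<otimes> p' \<oplus> b \<otimes> q')"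
      using assms(1,2) pq(1,2) pq'(1,2) u v by algebra
    also have "\<dots> = \<one>"
      using pq pq' u v by (simp add: u_def v_def)
    finally have "a [^] i \<otimes> (p \<oplus> v \<otimes> q \<otimes> p') \<oplus> b [^] Suc j \<otimes> (q \<otimes> q') = \<one>"
      by (simp add: u_def v_def)
    then show ?case
      using pq pq' u v by blast
  qed
qed

text \<open>With \<open>b = 1 - a\<close>, the powers \<open>a\<^sup>k\<close> and \<open>b\<^sup>k\<close> are comaximal and \<open>a\<^sup>k b\<^sup>k = 0\<close>, so the two summands of
  \<open>1\<close> are orthogonal and hence idempotent. The first one is \<open>\<equiv> 1\<close> modulo \<open>1 - a\<close> and \<open>\<equiv> 0\<close> modulo \<open>a\<close>,
  which makes its difference from \<open>a\<close> an explicit multiple of \<open>a (1 - a)\<close>. Both this factor and the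
  factor \<open>a\<close> of the idempotent are displayed, since nilpotency and membership are read off from them.\<close>

lemma (in cring) lift_idempotent:
  assumes a: "a \<in> carrier R" and nil: "(a \<otimes> (\<one> \<ominus> a)) [^] (k::nat) = \<zero>"
  shows "\<exists>p\<in>carrier R. \<exists>c\<in>carrier R.
    (a \<otimes> p) \<otimes> (a \<otimes> p) = a \<otimes> p \<and> a = a \<otimes> p \<oplus> (a \<otimes> (\<one> \<ominus> a)) \<otimes> c"
proof -
  let ?b = "\<one> \<ominus> a"
  have b: "?b \<in> carrier R" and ab: "a \<oplus> ?b = \<one>"
    using a by (simp, algebra)
  \<comment> \<open>The exponent \<open>Suc k\<close> leaves one factor \<open>a\<close>, resp. \<open>1 - a\<close>, to split off even when \<open>k = 0\<close>.\<close>
  obtain p q where p: "p \<in> carrier R" and q: "q \<in> carrier R"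
    and "a [^] Suc k \<otimes> p \<oplus> ?b [^] Suc k \<otimes> q = \<one>"
    using comaximal_power[OF a b ab] by blast
  have cl: "a [^] k \<in> carrier R" "?b [^] k \<in> carrier R" using a b by simp_all
  define p' q' where "p' = a [^] k \<otimes> p" and "q' = ?b [^] k \<otimes> q"
  have p': "p' \<in> carrier R" and q': "q' \<in> carrier R"
    using cl p q by (simp_all add: p'_def q'_def)
  have one: "a \<otimes> p' \<oplus> ?b \<otimes> q' = \<one>"
  proof -
    have "a \<otimes> p' = a [^] Suc k \<otimes> p" "?b \<otimes> q' = ?b [^] Suc k \<otimes> q"
      using a b p q cl by (simp_all add: p'_def q'_def m_ac)
    then show ?thesis
      using \<open>a [^] Suc k \<otimes> p \<oplus> ?b [^] Suc k \<otimes> q = \<one>\<close> by simp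
  qed
  have orth: "(a \<otimes> p') \<otimes> (?b \<otimes> q') = \<zero>"
  proof -
    have "(a \<otimes> p') \<otimes> (?b \<otimes> q') = (a \<otimes> ?b) \<otimes> (a [^] k \<otimes> ?b [^] k) \<otimes> (p \<otimes> q)"
      using a b p q cl by (simp add: p'_def q'_def m_ac)
    also have "a [^] k \<otimes> ?b [^] k = \<zero>"
      using nat_pow_distrib[OF a b, of k] nil by simp
    finally show ?thesis
      using a b p q by simp
  qed
  have "(a \<otimes> p') \<otimes> (a \<otimes> p') = (a \<otimes> p') \<otimes> (a \<otimes> p' \<oplus> ?b \<otimes> q')"
    using a b p' q' orth by (simp add: r_distr)
  then have idem: "(a \<otimes> p') \<otimes> (a \<otimes> p') = a \<otimes> p'"
    using a p' one by simp
  have "a = a \<otimes> (a \<otimes> p' \<oplus> ?b \<otimes> q')"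
    using a one by simp
  also have "\<dots> = a \<otimes> p' \<oplus> (a \<otimes> ?b) \<otimes> (q' \<ominus> p')"
    using a p' q' by algebra
  finally show ?thesis
    using idem p' q' by (intro bexI[of _ p'] bexI[of _ "q' \<ominus> p'"]) auto
qed

lemma (in ring) subring_uminus:
  assumes "subring H R" "h \<in> H"
  shows "\<ominus>\<^bsub>R\<lparr>carrier := H\<rparr>\<^esub> h = \<ominus> h"
proof -
  interpret H: ring "R\<lparr>carrier := H\<rparr>"
    using subring_is_ring[OF assms(1)] .
  show ?thesis
    using H.minus_equality[of "\<ominus> h" h] subringE(1,5)[OF assms(1)] assms(2)
    by (auto simp: l_neg)
qed

text \<open>The ambient ring for the idempotent construction: elements commuting with everything that commutes
  with \<open>x\<close> commute with each other, and those that multiply \<open>S\<close> into itself form a ring with identity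
  even if \<open>\<one>\<close> is not in \<open>S\<close>. It serves as a substitute for the ring of integer polynomials in \<open>x\<close>.\<close>

lemma (in ring) subring_of_commutant_and_idealizer:
  assumes x: "x \<in> carrier R" and S: "additive_subgroup S R"
  shows "subring {c \<in> carrier R. (\<forall>y\<in>carrier R. y \<otimes> x = x \<otimes> y \<longrightarrow> c \<otimes> y = y \<otimes> c) \<and>
    (\<forall>s\<in>S. c \<otimes> s \<in> S)} R" (is "subring ?C R")
proof (rule subringI)
  have Sc: "s \<in> carrier R" if "s \<in> S" for s
    using additive_subgroup.a_Hcarr[OF S that] .
  show "?C \<subseteq> carrier R" by blast
  show "\<one> \<in> ?C" using Sc by auto
  show "\<ominus> h \<in> ?C" if "h \<in> ?C" for h
    using that Sc additive_subgroup.a_inv_closed[OF S] by (auto simp: l_minus r_minus)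
  show "h1 \<otimes> h2 \<in> ?C" if h: "h1 \<in> ?C" "h2 \<in> ?C" for h1 h2
  proof -
    have "(h1 \<otimes> h2) \<otimes> y = y \<otimes> (h1 \<otimes> h2)" if y: "y \<in> carrier R" "y \<otimes> x = x \<otimes> y" for y
    proof -
      have "(h1 \<otimes> h2) \<otimes> y = h1 \<otimes> (y \<otimes> h2)"
        using h y by (simp add: m_assoc)
      also have "\<dots> = (h1 \<otimes> y) \<otimes> h2"
        using h y(1) by (simp add: m_assoc)
      also have "\<dots> = (y \<otimes> h1) \<otimes> h2"
        using h y by simp
      finally show ?thesis
        using h y(1) by (simp add: m_assoc)
    qed
    then show ?thesis
      using h Sc by (auto simp: m_assoc)
  qed
  show "h1 \<oplus> h2 \<in> ?C" if "h1 \<in> ?C" "h2 \<in> ?C" for h1 h2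
    using that Sc additive_subgroup.a_closed[OF S] by (auto simp: l_distr r_distr)
qed

lemma (in ring) nilpotent_mult_commute:
  assumes "nilpotent R b" "c \<in> carrier R" "b \<otimes> c = c \<otimes> b"
  shows "nilpotent R (b \<otimes> c)"
proof -
  obtain k :: nat where "b [^] k = \<zero>" "b \<in> carrier R"
    using assms(1) unfolding nilpotent_def by blast
  then have "(b \<otimes> c) [^] k = \<zero>"
    using assms pow_mult_distrib[of b c k] by simp
  then show ?thesis
    using assms \<open>b \<in> carrier R\<close> unfolding nilpotent_def by auto
qed

text \<open>Expanding and using that \<open>f\<close> is idempotent, \<open>x (1 - x) = b (1 - 2 f - b)\<close>, a nilpotent times an
  element commuting with it.\<close>

lemma (in ring) nilpotent_if_idempotent_plus_nilpotent:
  assumes f: "idempotent R f" and b: "nilpotent R b" and fb: "f \<otimes> b = b \<otimes> f"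
    and x: "x = f \<oplus> b"
  shows "nilpotent R (x \<otimes> (\<one> \<ominus> x))"
proof -
  have cl: "f \<in> carrier R" "b \<in> carrier R" and ff: "f \<otimes> f = f"
    using f b unfolding idempotent_def nilpotent_def by auto
  let ?c = "\<one> \<ominus> (f \<oplus> f) \<ominus> b"
  have "x \<otimes> (\<one> \<ominus> x) = f \<oplus> b \<ominus> (f \<otimes> f \<oplus> f \<otimes> b \<oplus> b \<otimes> f \<oplus> b \<otimes> b)"
    unfolding x using cl by (algebra, simp add: a_ac)
  also have "\<dots> = b \<oplus> (f \<ominus> f) \<ominus> (b \<otimes> f \<oplus> b \<otimes> f \<oplus> b \<otimes> b)"
    unfolding ff fb using cl by algebra
  also have "\<dots> = b \<otimes> ?c"
    using cl by (algebra, simp add: a_ac)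
  finally have eq: "x \<otimes> (\<one> \<ominus> x) = b \<otimes> ?c" .
  have "b \<otimes> ?c = b \<ominus> (b \<otimes> f \<oplus> b \<otimes> f) \<ominus> b \<otimes> b"
    using cl by (algebra, simp add: a_ac)
  also have "\<dots> = b \<ominus> (f \<otimes> b \<oplus> f \<otimes> b) \<ominus> b \<otimes> b"
    by (simp only: fb)
  also have "\<dots> = ?c \<otimes> b"
    using cl by (simp add: a_minus_def l_distr l_minus minus_add a_ac)
  finally show ?thesis
    unfolding eq using nilpotent_mult_commute[OF b] cl by simp
qed

text \<open>The idempotent is lifted from \<open>x\<close> inside the ring \<open>C\<close> of the lemma
  \<open>subring_of_commutant_and_idealizer\<close>. It is the product of \<open>x\<close> with an element of \<open>C\<close>, and \<open>C\<close>
  multiplies \<open>S\<close> into itself; so it lies in \<open>S\<close>, and with it its difference from \<open>x\<close>. In a graded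
  ring the unit component can play the part of \<open>S\<close>, which makes both summands homogeneous.\<close>

lemma (in ring) strongly_nil_clean_within:
  assumes S: "additive_subgroup S R" "\<And>y z. y \<in> S \<Longrightarrow> z \<in> S \<Longrightarrow> y \<otimes> z \<in> S"
    and x: "x \<in> S" and nil: "nilpotent R (x \<otimes> (\<one> \<ominus> x))"
  shows "\<exists>f\<in>S. \<exists>b\<in>S. idempotent R f \<and> nilpotent R b \<and> x = f \<oplus> b \<and> f \<otimes> b = b \<otimes> f"
proof -
  have xR: "x \<in> carrier R"
    using additive_subgroup.a_Hcarr[OF S(1) x] .
  define C where "C = {c \<in> carrier R. (\<forall>y\<in>carrier R. y \<otimes> x = x \<otimes> y \<longrightarrow> c \<otimes> y = y \<otimes> c) \<and>
    (\<forall>s\<in>S. c \<otimes> s \<in> S)}"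
  have sub: "subring C R"
    unfolding C_def by (rule subring_of_commutant_and_idealizer[OF xR S(1)])
  have CR: "C \<subseteq> carrier R" and xC: "x \<in> C"
    using xR x S(2) by (auto simp: C_def)
  have "subcring C R"
  proof (rule subcringI[OF sub])
    fix h1 h2 assume h: "h1 \<in> C" "h2 \<in> C"
    then have "h2 \<otimes> x = x \<otimes> h2" using xR by (auto simp: C_def)
    then show "h1 \<otimes> h2 = h2 \<otimes> h1" using h by (auto simp: C_def)
  qed
  then interpret K: cring "R\<lparr>carrier := C\<rparr>"
    using subcring_iff[OF CR] by simp
  have oneC: "\<one> \<in> C" using subringE(3)[OF sub] .
  have minus: "\<one> \<ominus>\<^bsub>R\<lparr>carrier := C\<rparr>\<^esub> x = \<one> \<ominus> x"
    using subring_uminus[OF sub xC] by (simp add: a_minus_def)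
  obtain k :: nat where "(x \<otimes> (\<one> \<ominus> x)) [^] k = \<zero>"
    using nil unfolding nilpotent_def by blast
  then obtain p c where p: "p \<in> C" and c: "c \<in> C"
    and idem: "(x \<otimes> p) \<otimes> (x \<otimes> p) = x \<otimes> p"
    and split: "x = x \<otimes> p \<oplus> (x \<otimes> (\<one> \<ominus> x)) \<otimes> c"
    using K.lift_idempotent[of x k] xC minus by (auto simp: nat_pow_def)
  define f b where "f = x \<otimes> p" and "b = (x \<otimes> (\<one> \<ominus> x)) \<otimes> c"
  have xxC: "x \<otimes> (\<one> \<ominus> x) \<in> C"
    using K.minus_closed[of \<one> x] minus oneC xC subringE(6)[OF sub] by simp
  have fC: "f \<in> C" and bC: "b \<in> C"
    using xC xxC p c subringE(6)[OF sub] by (auto simp: f_def b_def)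
  have fS: "f \<in> S"
    using p x xR K.m_comm[of x p] xC by (auto simp: f_def C_def)
  have eq: "x = f \<oplus> b" using split by (simp add: f_def b_def)
  have "b = x \<ominus> f"
    unfolding eq using subsetD[OF CR fC] subsetD[OF CR bC] by algebra
  then have bS: "b \<in> S"
    using x fS S(1) additive_subgroup.a_closed[OF S(1)] additive_subgroup.a_inv_closed[OF S(1)]
    by (simp add: a_minus_def)
  have nb: "nilpotent R b"
    unfolding b_def using nilpotent_mult_commute[OF nil] c xxC CR K.m_comm[of "x \<otimes> (\<one> \<ominus> x)" c] by auto
  have "idempotent R f" using idem fC CR by (auto simp: idempotent_def f_def)
  then show ?thesis
    using fS bS nb eq K.m_comm[of f b] fC bC by auto
qed

section \<open>Matrix rings and triangular matrices\<close>

lemma matrix_ring_simps: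
  "carrier (matrix_ring R n) = {M \<in> carrier_mat n n. \<forall>i<n. \<forall>j<n. M $$ (i, j) \<in> carrier R}"
  "M \<otimes>\<^bsub>matrix_ring R n\<^esub> N
    = mat n n (\<lambda>(i, j). \<Oplus>\<^bsub>R\<^esub>k\<in>{..<n}. M $$ (i, k) \<otimes>\<^bsub>R\<^esub> N $$ (k, j))"
  "\<one>\<^bsub>matrix_ring R n\<^esub> = mat n n (\<lambda>(i, j). if i = j then \<one>\<^bsub>R\<^esub> else \<zero>\<^bsub>R\<^esub>)"
  "\<zero>\<^bsub>matrix_ring R n\<^esub> = mat n n (\<lambda>_. \<zero>\<^bsub>R\<^esub>)"
  "M \<oplus>\<^bsub>matrix_ring R n\<^esub> N = mat n n (\<lambda>(i, j). M $$ (i, j) \<oplus>\<^bsub>R\<^esub> N $$ (i, j))"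
  by (simp_all add: matrix_ring_def)

text \<open>Needed for the associativity of matrix multiplication.\<close>

lemma (in abelian_monoid) finsum_swap:
  assumes "finite I" "finite J" "\<And>i j. i \<in> I \<Longrightarrow> j \<in> J \<Longrightarrow> f i j \<in> carrier G"
  shows "(\<Oplus>i\<in>I. \<Oplus>j\<in>J. f i j) = (\<Oplus>j\<in>J. \<Oplus>i\<in>I. f i j)"
  using assms(1,3)
proof (induction I)
  case empty
  then show ?case by simp
next
  case (insert a I)
  have "(\<Oplus>i\<in>insert a I. \<Oplus>j\<in>J. f i j) = (\<Oplus>j\<in>J. f a j) \<oplus> (\<Oplus>j\<in>J. \<Oplus>i\<in>I. f i j)"
    using insert by (subst finsum_insert) (auto intro!: finsum_closed)
  also have "\<dots> = (\<Oplus>j\<in>J. f a j \<oplus> (\<Oplus>i\<in>I. f i j))"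
    using insert.prems by (intro finsum_addf[symmetric]) (auto intro!: finsum_closed)
  also have "\<dots> = (\<Oplus>j\<in>J. \<Oplus>i\<in>insert a I. f i j)"
    using insert by (intro finsum_cong') (auto intro!: finsum_closed)
  finally show ?case .
qed

lemma (in abelian_monoid) finsum_single_term:
  assumes "finite I" "i \<in> I" "f \<in> I \<rightarrow> carrier G" "\<And>j. j \<in> I \<Longrightarrow> j \<noteq> i \<Longrightarrow> f j = \<zero>"
  shows "(\<Oplus>j\<in>I. f j) = f i"
proof -
  have "(\<Oplus>j\<in>I. f j) = (\<Oplus>j\<in>I. if i = j then f j else \<zero>)"
    using assms by (intro finsum_cong') auto
  also have "\<dots> = f i"
    using assms by (intro finsum_singleton) auto
  finally show ?thesis .
qed

lemma (in ring) matrix_ring: "ring (matrix_ring R n)"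
proof (intro ringI abelian_groupI monoidI)
  let ?M = "matrix_ring R n"
  fix A B C assume A: "A \<in> carrier ?M" and B: "B \<in> carrier ?M" and C: "C \<in> carrier ?M"
  then have ent: "A $$ (i, j) \<in> carrier R" "B $$ (i, j) \<in> carrier R" "C $$ (i, j) \<in> carrier R"
    if "i < n" "j < n" for i j
    using that by (simp_all add: matrix_ring_simps)
  show "A \<oplus>\<^bsub>?M\<^esub> B \<in> carrier ?M" "A \<otimes>\<^bsub>?M\<^esub> B \<in> carrier ?M"
    using A B by (auto simp: matrix_ring_simps intro!: finsum_closed)
  show "A \<oplus>\<^bsub>?M\<^esub> B \<oplus>\<^bsub>?M\<^esub> C = A \<oplus>\<^bsub>?M\<^esub> (B \<oplus>\<^bsub>?M\<^esub> C)"
    using A B C by (intro eq_matI) (auto simp: matrix_ring_simps a_assoc)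
  show "A \<oplus>\<^bsub>?M\<^esub> B = B \<oplus>\<^bsub>?M\<^esub> A"
    using A B by (intro eq_matI) (auto simp: matrix_ring_simps a_comm)
  show "(A \<oplus>\<^bsub>?M\<^esub> B) \<otimes>\<^bsub>?M\<^esub> C = A \<otimes>\<^bsub>?M\<^esub> C \<oplus>\<^bsub>?M\<^esub> B \<otimes>\<^bsub>?M\<^esub> C"
  proof (rule eq_matI)
    fix i j
    assume "i < dim_row (A \<otimes>\<^bsub>?M\<^esub> C \<oplus>\<^bsub>?M\<^esub> B \<otimes>\<^bsub>?M\<^esub> C)"
      "j < dim_col (A \<otimes>\<^bsub>?M\<^esub> C \<oplus>\<^bsub>?M\<^esub> B \<otimes>\<^bsub>?M\<^esub> C)"
    then have ij: "i < n" "j < n" by (auto simp: matrix_ring_simps)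
    have "((A \<oplus>\<^bsub>?M\<^esub> B) \<otimes>\<^bsub>?M\<^esub> C) $$ (i, j)
        = (\<Oplus>k\<in>{..<n}. A $$ (i, k) \<otimes> C $$ (k, j) \<oplus> B $$ (i, k) \<otimes> C $$ (k, j))"
      using ent ij by (auto simp: matrix_ring_simps l_distr simp del: finsum_addf intro!: finsum_cong')
    also have "\<dots> = (\<Oplus>k\<in>{..<n}. A $$ (i, k) \<otimes> C $$ (k, j)) \<oplus> (\<Oplus>k\<in>{..<n}. B $$ (i, k) \<otimes> C $$ (k, j))"
      using ent ij by (intro finsum_addf) auto
    also have "\<dots> = (A \<otimes>\<^bsub>?M\<^esub> C \<oplus>\<^bsub>?M\<^esub> B \<otimes>\<^bsub>?M\<^esub> C) $$ (i, j)"
      using ij by (simp add: matrix_ring_simps)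
    finally show "((A \<oplus>\<^bsub>?M\<^esub> B) \<otimes>\<^bsub>?M\<^esub> C) $$ (i, j) = \<dots>" .
  qed (simp_all add: matrix_ring_simps)
  show "C \<otimes>\<^bsub>?M\<^esub> (A \<oplus>\<^bsub>?M\<^esub> B) = C \<otimes>\<^bsub>?M\<^esub> A \<oplus>\<^bsub>?M\<^esub> C \<otimes>\<^bsub>?M\<^esub> B"
  proof (rule eq_matI)
    fix i j
    assume "i < dim_row (C \<otimes>\<^bsub>?M\<^esub> A \<oplus>\<^bsub>?M\<^esub> C \<otimes>\<^bsub>?M\<^esub> B)"
      "j < dim_col (C \<otimes>\<^bsub>?M\<^esub> A \<oplus>\<^bsub>?M\<^esub> C \<otimes>\<^bsub>?M\<^esub> B)"
    then have ij: "i < n" "j < n" by (auto simp: matrix_ring_simps)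
    have "(C \<otimes>\<^bsub>?M\<^esub> (A \<oplus>\<^bsub>?M\<^esub> B)) $$ (i, j)
        = (\<Oplus>k\<in>{..<n}. C $$ (i, k) \<otimes> A $$ (k, j) \<oplus> C $$ (i, k) \<otimes> B $$ (k, j))"
      using ent ij by (auto simp: matrix_ring_simps r_distr simp del: finsum_addf intro!: finsum_cong')
    also have "\<dots> = (\<Oplus>k\<in>{..<n}. C $$ (i, k) \<otimes> A $$ (k, j)) \<oplus> (\<Oplus>k\<in>{..<n}. C $$ (i, k) \<otimes> B $$ (k, j))"
      using ent ij by (intro finsum_addf) auto
    also have "\<dots> = (C \<otimes>\<^bsub>?M\<^esub> A \<oplus>\<^bsub>?M\<^esub> C \<otimes>\<^bsub>?M\<^esub> B) $$ (i, j)"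
      using ij by (simp add: matrix_ring_simps)
    finally show "(C \<otimes>\<^bsub>?M\<^esub> (A \<oplus>\<^bsub>?M\<^esub> B)) $$ (i, j) = \<dots>" .
  qed (simp_all add: matrix_ring_simps)
  show "A \<otimes>\<^bsub>?M\<^esub> B \<otimes>\<^bsub>?M\<^esub> C = A \<otimes>\<^bsub>?M\<^esub> (B \<otimes>\<^bsub>?M\<^esub> C)"
  proof (rule eq_matI)
    fix i j assume "i < dim_row (A \<otimes>\<^bsub>?M\<^esub> (B \<otimes>\<^bsub>?M\<^esub> C))" "j < dim_col (A \<otimes>\<^bsub>?M\<^esub> (B \<otimes>\<^bsub>?M\<^esub> C))"
    then have ij: "i < n" "j < n" by (auto simp: matrix_ring_simps)
    let ?t = "\<lambda>k l. A $$ (i, l) \<otimes> B $$ (l, k) \<otimes> C $$ (k, j)"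
    have "(A \<otimes>\<^bsub>?M\<^esub> B \<otimes>\<^bsub>?M\<^esub> C) $$ (i, j) = (\<Oplus>k\<in>{..<n}. \<Oplus>l\<in>{..<n}. ?t k l)"
      using ent ij
      by (auto simp: matrix_ring_simps finsum_ldistr intro!: finsum_cong' finsum_closed)
    also have "\<dots> = (\<Oplus>l\<in>{..<n}. \<Oplus>k\<in>{..<n}. ?t k l)"
      using ent ij by (intro finsum_swap) auto
    also have "\<dots> = (A \<otimes>\<^bsub>?M\<^esub> (B \<otimes>\<^bsub>?M\<^esub> C)) $$ (i, j)"
      using ent ij
      by (auto simp: matrix_ring_simps finsum_rdistr m_assoc intro!: finsum_cong' finsum_closed)
    finally show "(A \<otimes>\<^bsub>?M\<^esub> B \<otimes>\<^bsub>?M\<^esub> C) $$ (i, j) = (A \<otimes>\<^bsub>?M\<^esub> (B \<otimes>\<^bsub>?M\<^esub> C)) $$ (i, j)" .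
  qed (simp_all add: matrix_ring_simps)
next
  let ?M = "matrix_ring R n"
  show "\<zero>\<^bsub>?M\<^esub> \<in> carrier ?M" "\<one>\<^bsub>?M\<^esub> \<in> carrier ?M"
    by (auto simp: matrix_ring_simps)
  fix A assume A: "A \<in> carrier ?M"
  show "\<zero>\<^bsub>?M\<^esub> \<oplus>\<^bsub>?M\<^esub> A = A"
    using A by (intro eq_matI) (auto simp: matrix_ring_simps)
  show "\<exists>B\<in>carrier ?M. B \<oplus>\<^bsub>?M\<^esub> A = \<zero>\<^bsub>?M\<^esub>"
    using A by (intro bexI[of _ "mat n n (\<lambda>ij. \<ominus> (A $$ ij))"])
      (auto simp: matrix_ring_simps l_neg intro!: eq_matI)
  show "\<one>\<^bsub>?M\<^esub> \<otimes>\<^bsub>?M\<^esub> A = A"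
  proof (rule eq_matI)
    fix i j assume "i < dim_row A" "j < dim_col A"
    then have ij: "i < n" "j < n" using A by (auto simp: matrix_ring_simps)
    have "(\<one>\<^bsub>?M\<^esub> \<otimes>\<^bsub>?M\<^esub> A) $$ (i, j) = (\<Oplus>k\<in>{..<n}. \<one>\<^bsub>?M\<^esub> $$ (i, k) \<otimes> A $$ (k, j))"
      using ij by (simp add: matrix_ring_simps(2))
    also have "\<dots> = \<one>\<^bsub>?M\<^esub> $$ (i, i) \<otimes> A $$ (i, j)"
      using A ij by (intro finsum_single_term) (auto simp: matrix_ring_simps)
    finally show "(\<one>\<^bsub>?M\<^esub> \<otimes>\<^bsub>?M\<^esub> A) $$ (i, j) = A $$ (i, j)"
      using A ij by (simp add: matrix_ring_simps(1,3))
  qed (use A in \<open>auto simp: matrix_ring_simps\<close>)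
  show "A \<otimes>\<^bsub>?M\<^esub> \<one>\<^bsub>?M\<^esub> = A"
  proof (rule eq_matI)
    fix i j assume "i < dim_row A" "j < dim_col A"
    then have ij: "i < n" "j < n" using A by (auto simp: matrix_ring_simps)
    have "(A \<otimes>\<^bsub>?M\<^esub> \<one>\<^bsub>?M\<^esub>) $$ (i, j) = (\<Oplus>k\<in>{..<n}. A $$ (i, k) \<otimes> \<one>\<^bsub>?M\<^esub> $$ (k, j))"
      using ij by (simp add: matrix_ring_simps(2))
    also have "\<dots> = A $$ (i, j) \<otimes> \<one>\<^bsub>?M\<^esub> $$ (j, j)"
      using A ij by (intro finsum_single_term) (auto simp: matrix_ring_simps)
    finally show "(A \<otimes>\<^bsub>?M\<^esub> \<one>\<^bsub>?M\<^esub>) $$ (i, j) = A $$ (i, j)"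
      using A ij by (simp add: matrix_ring_simps(1,3))
  qed (use A in \<open>auto simp: matrix_ring_simps\<close>)
qed

lemma triangular_ring_simps:
  "carrier (triangular_ring R n)
    = {M \<in> carrier (matrix_ring R n). \<forall>i<n. \<forall>j<i. M $$ (i, j) = \<zero>\<^bsub>R\<^esub>}"
  "M \<otimes>\<^bsub>triangular_ring R n\<^esub> N = M \<otimes>\<^bsub>matrix_ring R n\<^esub> N"
  "M \<oplus>\<^bsub>triangular_ring R n\<^esub> N = M \<oplus>\<^bsub>matrix_ring R n\<^esub> N"
  "\<one>\<^bsub>triangular_ring R n\<^esub> = \<one>\<^bsub>matrix_ring R n\<^esub>"
  "\<zero>\<^bsub>triangular_ring R n\<^esub> = \<zero>\<^bsub>matrix_ring R n\<^esub>"
  by (simp_all add: triangular_ring_def)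

lemma (in ring) matrix_uminus_entry:
  assumes "M \<in> carrier (matrix_ring R n)" "i < n" "j < n"
  shows "(\<ominus>\<^bsub>matrix_ring R n\<^esub> M) $$ (i, j) = \<ominus> (M $$ (i, j))"
proof -
  interpret M: ring "matrix_ring R n" by (rule matrix_ring)
  have "(\<ominus>\<^bsub>matrix_ring R n\<^esub> M \<oplus>\<^bsub>matrix_ring R n\<^esub> M) $$ (i, j) = \<zero>\<^bsub>matrix_ring R n\<^esub> $$ (i, j)"
    using assms M.l_neg by simp
  then have "(\<ominus>\<^bsub>matrix_ring R n\<^esub> M) $$ (i, j) \<oplus> M $$ (i, j) = \<zero>"
    using assms(2,3) by (simp add: matrix_ring_simps)
  then show ?thesis
    using assms M.a_inv_closed[OF assms(1)] minus_equality[of "(\<ominus>\<^bsub>matrix_ring R n\<^esub> M) $$ (i, j)"]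
    by (auto simp: matrix_ring_simps(1))
qed

lemma (in ring) triangular_subring:
  "subring (carrier (triangular_ring R n)) (matrix_ring R n)"
proof -
  interpret M: ring "matrix_ring R n" by (rule matrix_ring)
  show ?thesis
  proof (rule M.subringI)
    show "h1 \<otimes>\<^bsub>matrix_ring R n\<^esub> h2 \<in> carrier (triangular_ring R n)"
      if h: "h1 \<in> carrier (triangular_ring R n)" "h2 \<in> carrier (triangular_ring R n)" for h1 h2
    proof -
      have "(\<Oplus>k\<in>{..<n}. h1 $$ (i, k) \<otimes> h2 $$ (k, j)) = \<zero>" if "i < n" "j < i" for i j
      proof (rule add.finprod_one_eqI)
        fix k assume "k \<in> {..<n}"
        then show "h1 $$ (i, k) \<otimes> h2 $$ (k, j) = \<zero>"
          using h that by (cases "k < i") (auto simp: triangular_ring_simps matrix_ring_simps)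
      qed
      then show ?thesis
        using h M.m_closed[of h1 h2]
        by (auto simp: triangular_ring_simps) (auto simp: matrix_ring_simps)
    qed
    show "\<ominus>\<^bsub>matrix_ring R n\<^esub> h \<in> carrier (triangular_ring R n)"
      if "h \<in> carrier (triangular_ring R n)" for h
      using that matrix_uminus_entry[of h n]
      by (auto simp: triangular_ring_simps)
    show "h1 \<oplus>\<^bsub>matrix_ring R n\<^esub> h2 \<in> carrier (triangular_ring R n)"
      if "h1 \<in> carrier (triangular_ring R n)" "h2 \<in> carrier (triangular_ring R n)" for h1 h2
      using that by (auto simp: triangular_ring_simps matrix_ring_simps)
  qed (auto simp: triangular_ring_simps matrix_ring_simps)
qed

lemma (in ring) triangular_ring: "ring (triangular_ring R n)"
  using ring.subring_is_ring[OF matrix_ring triangular_subring]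
  by (simp add: triangular_ring_def)

lemma (in ring) triangular_uminus_entry:
  assumes "M \<in> carrier (triangular_ring R n)" "i < n" "j < n"
  shows "(\<ominus>\<^bsub>triangular_ring R n\<^esub> M) $$ (i, j) = \<ominus> (M $$ (i, j))"
  using assms ring.subring_uminus[OF matrix_ring triangular_subring assms(1)]
    matrix_uminus_entry[of M n i j]
  by (simp add: triangular_ring_def)

lemma triangular_ring_entries:
  assumes "M \<in> carrier (triangular_ring R n)" "i < n" "j < n"
  shows "M $$ (i, j) \<in> carrier R" "j < i \<Longrightarrow> M $$ (i, j) = \<zero>\<^bsub>R\<^esub>"
  using assms by (auto simp: triangular_ring_simps matrix_ring_simps)

text \<open>Every term of the product sum other than the diagonal one has a factor below the diagonal. So
  reading off a diagonal entry is a ring homomorphism, which transports idempotency, nilpotency and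
  commutation from a triangular matrix to its entries.\<close>

lemma (in ring) triangular_diag_mult:
  assumes M: "M \<in> carrier (triangular_ring R n)" and N: "N \<in> carrier (triangular_ring R n)"
    and i: "i < n"
  shows "(M \<otimes>\<^bsub>triangular_ring R n\<^esub> N) $$ (i, i) = M $$ (i, i) \<otimes> N $$ (i, i)"
proof -
  have "(\<Oplus>k\<in>{..<n}. M $$ (i, k) \<otimes> N $$ (k, i)) = M $$ (i, i) \<otimes> N $$ (i, i)"
  proof (rule finsum_single_term)
    fix k assume "k \<in> {..<n}" "k \<noteq> i"
    then show "M $$ (i, k) \<otimes> N $$ (k, i) = \<zero>"
      using i triangular_ring_entries[OF M] triangular_ring_entries[OF N]
      by (cases "k < i") auto
  qed (use i triangular_ring_entries[OF M] triangular_ring_entries[OF N] in auto)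
  then show ?thesis
    using i by (simp add: triangular_ring_simps matrix_ring_simps)
qed

lemma (in ring) triangular_diag_pow:
  assumes M: "M \<in> carrier (triangular_ring R n)" and i: "i < n"
  shows "(M [^]\<^bsub>triangular_ring R n\<^esub> (k::nat)) $$ (i, i) = (M $$ (i, i)) [^] k"
proof -
  interpret T: ring "triangular_ring R n" by (rule triangular_ring)
  show ?thesis
  proof (induction k)
    case 0
    then show ?case using i by (simp add: triangular_ring_simps matrix_ring_simps)
  next
    case (Suc k)
    then show ?case
      using triangular_diag_mult[OF T.nat_pow_closed[OF M] M i, of k] by simp
  qed
qed

text \<open>Each multiplication by a strictly triangular matrix moves the possibly nonzero entries one further
  diagonal away from the main one.\<close>

lemma (in ring) strictly_triangular_pow:
  assumes M: "M \<in> carrier (triangular_ring R n)" and diag: "\<And>i. i < n \<Longrightarrow> M $$ (i, i) = \<zero>"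
    and "i < n" "j < n" "j < i + k"
  shows "(M [^]\<^bsub>triangular_ring R n\<^esub> (k::nat)) $$ (i, j) = \<zero>"
  using assms(3-)
proof (induction k arbitrary: i j)
  case 0
  then show ?case by (simp add: triangular_ring_simps matrix_ring_simps)
next
  case (Suc k)
  interpret T: ring "triangular_ring R n" by (rule triangular_ring)
  let ?P = "M [^]\<^bsub>triangular_ring R n\<^esub> k"
  have P: "?P \<in> carrier (triangular_ring R n)" using M by simp
  have "(\<Oplus>l\<in>{..<n}. ?P $$ (i, l) \<otimes> M $$ (l, j)) = \<zero>"
  proof (rule add.finprod_one_eqI)
    fix l assume l: "l \<in> {..<n}"
    show "?P $$ (i, l) \<otimes> M $$ (l, j) = \<zero>"
    proof (cases "l < i + k")
      case True
      then show ?thesis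
        using Suc l triangular_ring_entries(1)[OF M, of l j] by simp
    next
      case False
      then have "j \<le> l" using Suc.prems by simp
      then have "M $$ (l, j) = \<zero>"
        using diag[of l] triangular_ring_entries(2)[OF M, of l j] l Suc.prems
        by (cases "j = l") auto
      then show ?thesis
        using triangular_ring_entries(1)[OF P, of i l] l Suc.prems by simp
    qed
  qed
  then show ?case
    using Suc.prems by (simp add: triangular_ring_simps matrix_ring_simps)
qed

text \<open>For the nontrivial direction, a sufficiently high power of the matrix kills the whole diagonal at
  once, and the resulting strictly triangular \<open>n \<times> n\<close> matrix has \<open>n\<close>-th power zero.\<close>

lemma (in ring) nilpotent_triangular_iff:
  assumes M: "M \<in> carrier (triangular_ring R n)"
  shows "nilpotent (triangular_ring R n) M \<longleftrightarrow> (\<forall>i<n. nilpotent R (M $$ (i, i)))"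
proof
  assume "nilpotent (triangular_ring R n) M"
  then obtain k :: nat where k: "M [^]\<^bsub>triangular_ring R n\<^esub> k = \<zero>\<^bsub>triangular_ring R n\<^esub>"
    unfolding nilpotent_def by blast
  have "M $$ (i, i) [^] k = \<zero>" if "i < n" for i
    using triangular_diag_pow[OF M that, of k] k that
    by (simp add: triangular_ring_simps matrix_ring_simps)
  then show "\<forall>i<n. nilpotent R (M $$ (i, i))"
    using triangular_ring_entries(1)[OF M] unfolding nilpotent_def by blast
next
  interpret T: ring "triangular_ring R n" by (rule triangular_ring)
  assume "\<forall>i<n. nilpotent R (M $$ (i, i))"
  then obtain e :: "nat \<Rightarrow> nat" where e: "\<And>i. i < n \<Longrightarrow> M $$ (i, i) [^] e i = \<zero>"
    unfolding nilpotent_def by metis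
  \<comment> \<open>The sum bounds all exponents, including the case \<open>n = 0\<close>, where a maximum is undefined.\<close>
  define K where "K = (\<Sum>i<n. e i)"
  let ?N = "M [^]\<^bsub>triangular_ring R n\<^esub> K"
  have N: "?N \<in> carrier (triangular_ring R n)" using M by simp
  have diag: "?N $$ (i, i) = \<zero>" if i: "i < n" for i
  proof -
    have "e i \<le> K"
      using i member_le_sum[of i "{..<n}" e] by (simp add: K_def)
    then have "M $$ (i, i) [^] K = M $$ (i, i) [^] e i \<otimes> M $$ (i, i) [^] (K - e i)"
      using triangular_ring_entries(1)[OF M i i] by (simp add: nat_pow_mult)
    then show ?thesis
      using e[OF i] triangular_ring_entries(1)[OF M i i] triangular_diag_pow[OF M i, of K] by simp
  qed
  have "?N [^]\<^bsub>triangular_ring R n\<^esub> n = \<zero>\<^bsub>triangular_ring R n\<^esub>"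
  proof (rule eq_matI)
    fix i j
    assume "i < dim_row \<zero>\<^bsub>triangular_ring R n\<^esub>" "j < dim_col \<zero>\<^bsub>triangular_ring R n\<^esub>"
    then have "i < n" "j < n" by (simp_all add: triangular_ring_simps matrix_ring_simps)
    then show "(?N [^]\<^bsub>triangular_ring R n\<^esub> n) $$ (i, j) = \<zero>\<^bsub>triangular_ring R n\<^esub> $$ (i, j)"
      using strictly_triangular_pow[OF N diag, of i j n]
      by (simp add: triangular_ring_simps matrix_ring_simps)
  qed (use T.nat_pow_closed[OF N, of n] in
      \<open>auto simp: triangular_ring_simps(1,5) matrix_ring_simps(1,4)\<close>)
  then show "nilpotent (triangular_ring R n) M"
    using M T.nat_pow_pow[OF M, of K n] unfolding nilpotent_def by metis
qed

lemma (in ring) idempotent_diag: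
  assumes "idempotent (triangular_ring R n) M" "i < n"
  shows "idempotent R (M $$ (i, i))"
  using assms triangular_diag_mult[of M n M i] triangular_ring_entries(1)[of M R n i i]
  unfolding idempotent_def by simp

lemma (in abelian_group) additive_subgroup_finsum_closed:
  assumes "additive_subgroup H G" "\<And>i. i \<in> I \<Longrightarrow> f i \<in> H"
  shows "(\<Oplus>i\<in>I. f i) \<in> H"
proof (cases "finite I")
  case True
  then show ?thesis
    using assms(2)
  proof (induction I)
    case empty
    then show ?case using additive_subgroup.zero_closed[OF assms(1)] by simp
  next
    case (insert a I)
    then show ?case
      using additive_subgroup.a_closed[OF assms(1)] additive_subgroup.a_Hcarr[OF assms(1)]
      by (subst finsum_insert) auto
  qed
next
  case False
  then show ?thesis
    using additive_subgroup.zero_closed[OF assms(1)] finsum_infinite by simp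
qed

section \<open>Degrees of idempotents and nilpotents\<close>

context graded_ring
begin

lemma component_subset: "g \<in> carrier G \<Longrightarrow> A g \<subseteq> carrier R"
  using additive_subgroup.a_subset[OF component_additive_subgroup] .

lemma zero_in_component: "g \<in> carrier G \<Longrightarrow> \<zero>\<^bsub>R\<^esub> \<in> A g"
  using additive_subgroup.zero_closed[OF component_additive_subgroup] .

text \<open>The direct sum decomposition speaks of functions on the whole group and of their supports; this
  reformulates its uniqueness part for families over a finite set, where zero terms are allowed.\<close>

lemma components_independent:
  assumes F: "finite F" "F \<subseteq> carrier G"
    and c: "\<And>g. g \<in> F \<Longrightarrow> c g \<in> A g" and d: "\<And>g. g \<in> F \<Longrightarrow> d g \<in> A g"
    and eq: "(\<Oplus>\<^bsub>R\<^esub>g\<in>F. c g) = (\<Oplus>\<^bsub>R\<^esub>g\<in>F. d g)" and g: "g \<in> F"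
  shows "c g = d g"
proof -
  define ext where "ext u = (\<lambda>g\<in>carrier G. if g \<in> F then u g else \<zero>\<^bsub>R\<^esub>)" for u :: "'g \<Rightarrow> 'r"
  have FA: "u \<in> F \<rightarrow> carrier R" if "\<And>g. g \<in> F \<Longrightarrow> u g \<in> A g" for u
    using that F(2) component_subset by blast
  have ext: "ext u \<in> (\<Pi>\<^sub>E g\<in>carrier G. A g)
      \<and> finite {g \<in> carrier G. ext u g \<noteq> \<zero>\<^bsub>R\<^esub>}
      \<and> (\<Oplus>\<^bsub>R\<^esub>g\<in>F. u g) = (\<Oplus>\<^bsub>R\<^esub>g\<in>{g \<in> carrier G. ext u g \<noteq> \<zero>\<^bsub>R\<^esub>}. ext u g)"
    if u: "\<And>g. g \<in> F \<Longrightarrow> u g \<in> A g" for u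
  proof (intro conjI)
    show "ext u \<in> (\<Pi>\<^sub>E g\<in>carrier G. A g)"
      using u zero_in_component by (auto simp: ext_def)
    have sub: "{g \<in> carrier G. ext u g \<noteq> \<zero>\<^bsub>R\<^esub>} \<subseteq> F"
      by (auto simp: ext_def)
    then show "finite {g \<in> carrier G. ext u g \<noteq> \<zero>\<^bsub>R\<^esub>}"
      using F(1) finite_subset by blast
    show "(\<Oplus>\<^bsub>R\<^esub>g\<in>F. u g) = (\<Oplus>\<^bsub>R\<^esub>g\<in>{g \<in> carrier G. ext u g \<noteq> \<zero>\<^bsub>R\<^esub>}. ext u g)"
    proof (rule R.add.finprod_mono_neutral_cong_right[OF F(1) sub])
      show "u \<in> F \<rightarrow> carrier R"
        by (rule FA) (rule u)
      show "u g = \<zero>\<^bsub>R\<^esub>" if "g \<in> F - {g \<in> carrier G. ext u g \<noteq> \<zero>\<^bsub>R\<^esub>}" for g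
        using that F(2) by (auto simp: ext_def)
      show "u g = ext u g" if "g \<in> {g \<in> carrier G. ext u g \<noteq> \<zero>\<^bsub>R\<^esub>}" for g
        using that by (simp add: ext_def split: if_splits)
    qed
  qed
  have "(\<Oplus>\<^bsub>R\<^esub>g\<in>F. c g) \<in> carrier R"
    using FA[of c, OF c] by (rule R.finsum_closed)
  from direct_sum[OF this] have "ext c = ext d"
  proof (rule ex1E)
    fix e assume "\<forall>e'. e' \<in> (\<Pi>\<^sub>E g\<in>carrier G. A g)
        \<and> finite {g \<in> carrier G. e' g \<noteq> \<zero>\<^bsub>R\<^esub>}
        \<and> (\<Oplus>\<^bsub>R\<^esub>g\<in>F. c g) = (\<Oplus>\<^bsub>R\<^esub>g\<in>{g \<in> carrier G. e' g \<noteq> \<zero>\<^bsub>R\<^esub>}. e' g) \<longrightarrow> e' = e"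
    note unique = this[rule_format]
    have "ext c = e"
      by (rule unique) (rule ext[OF c])
    moreover have "ext d = e"
      by (rule unique) (subst eq, rule ext[OF d])
    ultimately show ?thesis by simp
  qed
  then have "ext c g = ext d g" by simp
  then show ?thesis
    using g F(2) by (auto simp: ext_def)
qed

text \<open>If \<open>x\<close> and \<open>f\<close> have different degrees, the component of \<open>f + b\<close> in the degree of \<open>x\<close> comes from \<open>b\<close>
  alone. The degrees \<open>h\<close> and \<open>k\<close> may coincide with each other, and \<open>k\<close> with \<open>g\<close>; writing each element as
  a family concentrated in its degree treats all these cases together.\<close>

lemma homogeneous_sum_degree:
  assumes x: "x \<in> A g" "g \<in> carrier G" and f: "f \<in> A h" "h \<in> carrier G"
    and b: "b \<in> A k" "k \<in> carrier G"
    and sum: "x = f \<oplus>\<^bsub>R\<^esub> b" and "g \<noteq> h"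
  shows "x = b \<or> x = \<zero>\<^bsub>R\<^esub>"
proof -
  let ?F = "{g, h, k}"
  let ?\<delta> = "\<lambda>l y m. if l = m then y else \<zero>\<^bsub>R\<^esub>"
  have cl: "x \<in> carrier R" "f \<in> carrier R" "b \<in> carrier R"
    using assms component_subset by blast+
  have delta: "(\<Oplus>\<^bsub>R\<^esub>m\<in>?F. ?\<delta> l y m) = y" if "l \<in> ?F" "y \<in> carrier R" for l y
    using that R.finsum_singleton[of l ?F "\<lambda>_. y"] by simp
  have "(\<Oplus>\<^bsub>R\<^esub>m\<in>?F. ?\<delta> h f m \<oplus>\<^bsub>R\<^esub> ?\<delta> k b m) = (\<Oplus>\<^bsub>R\<^esub>m\<in>?F. ?\<delta> h f m) \<oplus>\<^bsub>R\<^esub> (\<Oplus>\<^bsub>R\<^esub>m\<in>?F. ?\<delta> k b m)"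
    using cl by (intro R.finsum_addf) auto
  then have "(\<Oplus>\<^bsub>R\<^esub>m\<in>?F. ?\<delta> g x m) = (\<Oplus>\<^bsub>R\<^esub>m\<in>?F. ?\<delta> h f m \<oplus>\<^bsub>R\<^esub> ?\<delta> k b m)"
    using cl delta[of g x] delta[of h f] delta[of k b] sum by simp
  moreover have "?\<delta> h f m \<oplus>\<^bsub>R\<^esub> ?\<delta> k b m \<in> A m" if "m \<in> ?F" for m
    using that assms zero_in_component
    by (intro additive_subgroup.a_closed[OF component_additive_subgroup]) auto
  moreover have "?\<delta> g x m \<in> A m" if "m \<in> ?F" for m
    using that assms zero_in_component by auto
  ultimately have "?\<delta> g x g = ?\<delta> h f g \<oplus>\<^bsub>R\<^esub> ?\<delta> k b g"
    using x(2) f(2) b(2)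
      components_independent[of ?F "?\<delta> g x" "\<lambda>m. ?\<delta> h f m \<oplus>\<^bsub>R\<^esub> ?\<delta> k b m" g]
    by blast
  then show ?thesis
    using \<open>g \<noteq> h\<close> cl by (auto split: if_splits)
qed

text \<open>An idempotent \<open>f = f f\<close> lies both in degree \<open>h\<close> and in degree \<open>h h\<close>. If \<open>h\<close> is not the
  unit, these differ and \<open>f\<close> is zero, which belongs to every component.\<close>

lemma idempotent_degree:
  assumes f: "f \<in> A h" "h \<in> carrier G" and idem: "idempotent R f"
  shows "f \<in> A \<one>\<^bsub>G\<^esub>"
proof (cases "h = \<one>\<^bsub>G\<^esub>")
  case False
  have ff: "f \<in> A (h \<otimes>\<^bsub>G\<^esub> h)"
    using component_mult[of h h f f] f idem by (simp add: idempotent_def)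
  have "h \<noteq> h \<otimes>\<^bsub>G\<^esub> h"
    using False f(2) G.r_cancel_one' by metis
  then have "f = \<zero>\<^bsub>R\<^esub>"
    using homogeneous_sum_degree[of f h f "h \<otimes>\<^bsub>G\<^esub> h" "\<zero>\<^bsub>R\<^esub>" h] ff f zero_in_component
      subsetD[OF component_subset[OF f(2)] f(1)] by auto
  then show ?thesis
    using zero_in_component by simp
qed (use f in simp)

lemma graded_nil_cleanE:
  assumes clean: "graded_nil_clean G R A" and x: "x \<in> A g" "g \<in> carrier G"
  obtains f b k where "f \<in> A \<one>\<^bsub>G\<^esub>" "b \<in> A k" "k \<in> carrier G"
    "idempotent R f" "nilpotent R b" "x = f \<oplus>\<^bsub>R\<^esub> b"
proof -
  have "x \<in> homogeneous G A"
    using x by (auto simp: homogeneous_def)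
  then obtain f b where fb: "f \<in> homogeneous G A" "b \<in> homogeneous G A"
    "idempotent R f" "nilpotent R b" "x = f \<oplus>\<^bsub>R\<^esub> b"
    using clean unfolding graded_nil_clean_def graded_nil_clean_elem_def by blast
  from fb(1) obtain h where h: "h \<in> carrier G" "f \<in> A h"
    by (auto simp: homogeneous_def)
  from fb(2) obtain k where k: "k \<in> carrier G" "b \<in> A k"
    by (auto simp: homogeneous_def)
  show thesis
    using that[OF idempotent_degree[OF h(2,1) fb(3)] k(2,1) fb(3-5)] .
qed

text \<open>The idempotent summand has unit degree, hence contributes nothing in the degree of \<open>x\<close>.\<close>

lemma nilpotent_off_unit_degree:
  assumes clean: "graded_nil_clean G R A" and x: "x \<in> A g" "g \<in> carrier G" "g \<noteq> \<one>\<^bsub>G\<^esub>"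
  shows "nilpotent R x"
proof -
  obtain f b k where fb: "f \<in> A \<one>\<^bsub>G\<^esub>" "b \<in> A k" "k \<in> carrier G"
    "nilpotent R b" "x = f \<oplus>\<^bsub>R\<^esub> b"
    using graded_nil_cleanE[OF clean x(1,2)] by metis
  have "x = b \<or> x = \<zero>\<^bsub>R\<^esub>"
    using homogeneous_sum_degree[OF x(1,2) fb(1) _ fb(2,3,5) x(3)] by simp
  moreover have "nilpotent R \<zero>\<^bsub>R\<^esub>"
    unfolding nilpotent_def by (intro conjI exI[of _ 1]) auto
  ultimately show ?thesis
    using fb(4) by blast
qed

section \<open>From a graded ring to its triangular matrices\<close>

lemma triangular_component_iff:
  "M \<in> triangular_component G R A n \<sigma> d \<longleftrightarrow> M \<in> carrier (triangular_ring R n) \<and>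
    (\<forall>i<n. \<forall>j<n. M $$ (i, j) \<in> A (\<sigma> i \<otimes>\<^bsub>G\<^esub> d \<otimes>\<^bsub>G\<^esub> inv\<^bsub>G\<^esub> (\<sigma> j)))"
  by (auto simp: triangular_component_def matrix_component_def triangular_ring_simps)

lemma triangular_component_additive_subgroup:
  assumes \<sigma>: "\<And>i. i < n \<Longrightarrow> \<sigma> i \<in> carrier G" and d: "d \<in> carrier G"
  shows "additive_subgroup (triangular_component G R A n \<sigma> d) (triangular_ring R n)"
proof -
  interpret T: ring "triangular_ring R n" by (rule R.triangular_ring)
  have deg: "\<sigma> i \<otimes>\<^bsub>G\<^esub> d \<otimes>\<^bsub>G\<^esub> inv\<^bsub>G\<^esub> (\<sigma> j) \<in> carrier G" if "i < n" "j < n" for i j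
    using \<sigma> d that by simp
  show ?thesis
  proof (intro additive_subgroup.intro T.add.subgroupI)
    have "\<zero>\<^bsub>triangular_ring R n\<^esub> \<in> triangular_component G R A n \<sigma> d"
      unfolding triangular_component_iff
      using zero_in_component[OF deg] T.zero_closed
      by (simp add: triangular_ring_simps(5) matrix_ring_simps(4))
    then show "triangular_component G R A n \<sigma> d \<noteq> {}" by blast
    show "\<ominus>\<^bsub>triangular_ring R n\<^esub> M \<in> triangular_component G R A n \<sigma> d"
      if "M \<in> triangular_component G R A n \<sigma> d" for M
      using that R.triangular_uminus_entry[of M n]
        additive_subgroup.a_inv_closed[OF component_additive_subgroup[OF deg]]
      by (auto simp: triangular_component_iff)
    show "M \<oplus>\<^bsub>triangular_ring R n\<^esub> N \<in> triangular_component G R A n \<sigma> d"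
      if "M \<in> triangular_component G R A n \<sigma> d" "N \<in> triangular_component G R A n \<sigma> d" for M N
      using that T.a_closed[of M N]
        additive_subgroup.a_closed[OF component_additive_subgroup[OF deg]]
      by (auto simp: triangular_component_iff) (auto simp: triangular_ring_simps matrix_ring_simps)
  qed (auto simp: triangular_component_iff)
qed

text \<open>The inner degrees cancel: \<open>(\<sigma>\<^sub>i \<sigma>\<^sub>k\<^sup>-\<^sup>1) (\<sigma>\<^sub>k \<sigma>\<^sub>j\<^sup>-\<^sup>1) = \<sigma>\<^sub>i \<sigma>\<^sub>j\<^sup>-\<^sup>1\<close>, so all terms of the product sum lie in one
  component of \<open>R\<close>.\<close>

lemma unit_component_mult_closed:
  assumes \<sigma>: "\<And>i. i < n \<Longrightarrow> \<sigma> i \<in> carrier G"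
    and M: "M \<in> triangular_component G R A n \<sigma> \<one>\<^bsub>G\<^esub>"
    and N: "N \<in> triangular_component G R A n \<sigma> \<one>\<^bsub>G\<^esub>"
  shows "M \<otimes>\<^bsub>triangular_ring R n\<^esub> N \<in> triangular_component G R A n \<sigma> \<one>\<^bsub>G\<^esub>"
proof -
  interpret T: ring "triangular_ring R n" by (rule R.triangular_ring)
  let ?d = "\<lambda>i j. \<sigma> i \<otimes>\<^bsub>G\<^esub> \<one>\<^bsub>G\<^esub> \<otimes>\<^bsub>G\<^esub> inv\<^bsub>G\<^esub> (\<sigma> j)"
  have "(M \<otimes>\<^bsub>triangular_ring R n\<^esub> N) $$ (i, j) \<in> A (?d i j)" if ij: "i < n" "j < n" for i j
  proof -
    have "M $$ (i, k) \<otimes>\<^bsub>R\<^esub> N $$ (k, j) \<in> A (?d i j)" if k: "k < n" for k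
    proof -
      have "?d i k \<otimes>\<^bsub>G\<^esub> ?d k j = ?d i j"
        using \<sigma>[OF ij(1)] \<sigma>[OF ij(2)] \<sigma>[OF k]
          G.m_assoc[of "inv\<^bsub>G\<^esub> (\<sigma> k)" "\<sigma> k" "inv\<^bsub>G\<^esub> (\<sigma> j)", symmetric]
        by (simp add: G.m_assoc)
      then show ?thesis
        using component_mult[of "?d i k" "?d k j" "M $$ (i, k)" "N $$ (k, j)"] M N ij k \<sigma>
        by (simp add: triangular_component_iff)
    qed
    then have "(\<Oplus>\<^bsub>R\<^esub>k\<in>{..<n}. M $$ (i, k) \<otimes>\<^bsub>R\<^esub> N $$ (k, j)) \<in> A (?d i j)"
      using ij \<sigma> by (intro R.additive_subgroup_finsum_closed component_additive_subgroup) auto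
    then show ?thesis
      using ij by (simp add: triangular_ring_simps matrix_ring_simps)
  qed
  then show ?thesis
    using M N T.m_closed by (simp add: triangular_component_iff)
qed

lemma triangular_diag_degree:
  assumes "M \<in> triangular_component G R A n \<sigma> d" "i < n"
  shows "M $$ (i, i) \<in> A (\<sigma> i \<otimes>\<^bsub>G\<^esub> d \<otimes>\<^bsub>G\<^esub> inv\<^bsub>G\<^esub> (\<sigma> i))"
  using assms by (simp add: triangular_component_iff)

text \<open>The diagonal entries have degrees conjugate to \<open>d\<close>, so they are not of unit degree and are nilpotent.
  Hence \<open>M\<close> is nilpotent and \<open>0 + M\<close> is a decomposition; its summands commute, so this one lemma
  covers the strong version as well.\<close>

lemma triangular_off_unit_degree:
  assumes clean: "graded_nil_clean G R A" and \<sigma>: "\<And>i. i < n \<Longrightarrow> \<sigma> i \<in> carrier G"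
    and M: "M \<in> triangular_component G R A n \<sigma> d" and d: "d \<in> carrier G" "d \<noteq> \<one>\<^bsub>G\<^esub>"
  shows "graded_strongly_nil_clean_elem G (triangular_ring R n) (triangular_component G R A n \<sigma>) M"
proof -
  interpret T: ring "triangular_ring R n" by (rule R.triangular_ring)
  have MT: "M \<in> carrier (triangular_ring R n)"
    using M by (simp add: triangular_component_iff)
  have "nilpotent R (M $$ (i, i))" if i: "i < n" for i
  proof (rule nilpotent_off_unit_degree[OF clean triangular_diag_degree[OF M i]])
    show "\<sigma> i \<otimes>\<^bsub>G\<^esub> d \<otimes>\<^bsub>G\<^esub> inv\<^bsub>G\<^esub> (\<sigma> i) \<in> carrier G"
      using \<sigma>[OF i] d by simp
    show "\<sigma> i \<otimes>\<^bsub>G\<^esub> d \<otimes>\<^bsub>G\<^esub> inv\<^bsub>G\<^esub> (\<sigma> i) \<noteq> \<one>\<^bsub>G\<^esub>"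
    proof
      assume "\<sigma> i \<otimes>\<^bsub>G\<^esub> d \<otimes>\<^bsub>G\<^esub> inv\<^bsub>G\<^esub> (\<sigma> i) = \<one>\<^bsub>G\<^esub>"
      then have "\<sigma> i \<otimes>\<^bsub>G\<^esub> d = \<sigma> i"
        using \<sigma>[OF i] d by (metis G.inv_closed G.inv_equality G.inv_inv G.m_closed)
      then show False
        using \<sigma>[OF i] d by (simp add: G.l_cancel_one)
    qed
  qed
  then have "nilpotent (triangular_ring R n) M"
    using R.nilpotent_triangular_iff[OF MT] by blast
  moreover have "\<zero>\<^bsub>triangular_ring R n\<^esub> \<in> triangular_component G R A n \<sigma> d"
    using additive_subgroup.zero_closed[OF triangular_component_additive_subgroup[of n \<sigma> d]] \<sigma> d(1) by blast
  moreover have "idempotent (triangular_ring R n) \<zero>\<^bsub>triangular_ring R n\<^esub>"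
    by (simp add: idempotent_def)
  ultimately show ?thesis
    unfolding graded_strongly_nil_clean_elem_def homogeneous_def
    using M MT d(1)
    by (intro bexI[of _ "\<zero>\<^bsub>triangular_ring R n\<^esub>"] bexI[of _ M]) auto
qed

text \<open>The idempotent is the diagonal matrix of idempotent parts of the diagonal entries. It is homogeneous
  of unit degree because those parts are, and subtracting it from \<open>M\<close> leaves nilpotents on the
  diagonal.\<close>

lemma triangular_unit_degree_nil_clean:
  assumes clean: "graded_nil_clean G R A" and \<sigma>: "\<And>i. i < n \<Longrightarrow> \<sigma> i \<in> carrier G"
    and M: "M \<in> triangular_component G R A n \<sigma> \<one>\<^bsub>G\<^esub>"
  shows "graded_nil_clean_elem G (triangular_ring R n) (triangular_component G R A n \<sigma>) M"
proof -
  let ?T = "triangular_ring R n" and ?S = "triangular_component G R A n \<sigma> \<one>\<^bsub>G\<^esub>"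
  interpret T: ring ?T by (rule R.triangular_ring)
  have MT: "M \<in> carrier ?T"
    using M by (simp add: triangular_component_iff)
  have "\<exists>f b. f \<in> A \<one>\<^bsub>G\<^esub> \<and> idempotent R f \<and> nilpotent R b \<and> M $$ (i, i) = f \<oplus>\<^bsub>R\<^esub> b"
    if i: "i < n" for i
  proof -
    have "M $$ (i, i) \<in> A \<one>\<^bsub>G\<^esub>"
      using triangular_diag_degree[OF M i] \<sigma>[OF i] by simp
    then show ?thesis
      using graded_nil_cleanE[OF clean, of "M $$ (i, i)" "\<one>\<^bsub>G\<^esub>"] by (metis G.one_closed)
  qed
  then obtain f b where fb: "\<And>i. i < n \<Longrightarrow> f i \<in> A \<one>\<^bsub>G\<^esub>" "\<And>i. i < n \<Longrightarrow> idempotent R (f i)"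
    "\<And>i. i < n \<Longrightarrow> nilpotent R (b i)" "\<And>i. i < n \<Longrightarrow> M $$ (i, i) = f i \<oplus>\<^bsub>R\<^esub> b i"
    by metis
  have cl: "f i \<in> carrier R" "b i \<in> carrier R" "f i \<otimes>\<^bsub>R\<^esub> f i = f i" if "i < n" for i
    using fb that by (auto simp: idempotent_def nilpotent_def)
  define F where "F = mat n n (\<lambda>(i, j). if i = j then f i else \<zero>\<^bsub>R\<^esub>)"
  have FT: "F \<in> carrier ?T"
    using cl by (auto simp: F_def triangular_ring_simps matrix_ring_simps)
  have FS: "F \<in> ?S"
    using FT fb(1) zero_in_component \<sigma> by (auto simp: triangular_component_iff F_def)
  have "F \<otimes>\<^bsub>?T\<^esub> F = F"
  proof (rule eq_matI)
    fix i j assume "i < dim_row F" "j < dim_col F"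
    then have ij: "i < n" "j < n" by (simp_all add: F_def)
    have "(\<Oplus>\<^bsub>R\<^esub>k\<in>{..<n}. F $$ (i, k) \<otimes>\<^bsub>R\<^esub> F $$ (k, j)) = F $$ (i, i) \<otimes>\<^bsub>R\<^esub> F $$ (i, j)"
      using ij cl by (intro R.finsum_single_term) (auto simp: F_def)
    also have "\<dots> = F $$ (i, j)"
      using ij cl by (auto simp: F_def)
    finally show "(F \<otimes>\<^bsub>?T\<^esub> F) $$ (i, j) = F $$ (i, j)"
      using ij by (simp add: triangular_ring_simps matrix_ring_simps)
  qed (simp_all add: F_def triangular_ring_simps matrix_ring_simps)
  then have "idempotent ?T F"
    using FT by (simp add: idempotent_def)
  moreover
  let ?B = "M \<ominus>\<^bsub>?T\<^esub> F"
  have S: "additive_subgroup ?S ?T"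
    using triangular_component_additive_subgroup \<sigma> by blast
  have BS: "?B \<in> ?S"
    unfolding a_minus_def
    using additive_subgroup.a_closed[OF S M] additive_subgroup.a_inv_closed[OF S FS] by blast
  have "?B $$ (i, i) = b i" if i: "i < n" for i
  proof -
    have "?B $$ (i, i) = (f i \<oplus>\<^bsub>R\<^esub> b i) \<oplus>\<^bsub>R\<^esub> \<ominus>\<^bsub>R\<^esub> (F $$ (i, i))"
      using i R.triangular_uminus_entry[OF FT i i] fb(4)[OF i]
      by (simp add: a_minus_def triangular_ring_simps matrix_ring_simps)
    also have "F $$ (i, i) = f i"
      using i by (simp add: F_def)
    also have "f i \<oplus>\<^bsub>R\<^esub> b i \<oplus>\<^bsub>R\<^esub> \<ominus>\<^bsub>R\<^esub> f i = b i"
      using cl[OF i] by algebra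
    finally show ?thesis .
  qed
  then have "nilpotent ?T ?B"
    using R.nilpotent_triangular_iff[of ?B n] fb(3) T.minus_closed[OF MT FT] by simp
  moreover have "M = F \<oplus>\<^bsub>?T\<^esub> ?B"
    using MT FT by (simp add: a_minus_def T.a_lcomm[of F M] T.r_neg)
  ultimately show ?thesis
    unfolding graded_nil_clean_elem_def homogeneous_def using FS BS by blast
qed

text \<open>A diagonal idempotent need not commute with \<open>M\<close>. Instead, \<open>M (1 - M)\<close> has nilpotent diagonal, hence is
  nilpotent, and the idempotent is obtained from \<open>M\<close> inside the unit component.\<close>

lemma triangular_unit_degree_strongly_nil_clean:
  assumes clean: "graded_strongly_nil_clean G R A" and \<sigma>: "\<And>i. i < n \<Longrightarrow> \<sigma> i \<in> carrier G"
    and M: "M \<in> triangular_component G R A n \<sigma> \<one>\<^bsub>G\<^esub>"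
  shows "graded_strongly_nil_clean_elem G (triangular_ring R n) (triangular_component G R A n \<sigma>) M"
proof -
  let ?T = "triangular_ring R n" and ?S = "triangular_component G R A n \<sigma> \<one>\<^bsub>G\<^esub>"
  interpret T: ring ?T by (rule R.triangular_ring)
  have MT: "M \<in> carrier ?T"
    using M by (simp add: triangular_component_iff)
  have S: "additive_subgroup ?S ?T"
    using triangular_component_additive_subgroup \<sigma> by blast
  let ?D = "M \<otimes>\<^bsub>?T\<^esub> (\<one>\<^bsub>?T\<^esub> \<ominus>\<^bsub>?T\<^esub> M)"
  have "nilpotent R (?D $$ (i, i))" if i: "i < n" for i
  proof -
    let ?x = "M $$ (i, i)"
    have "?x \<in> homogeneous G A"
      using triangular_diag_degree[OF M i] \<sigma>[OF i] by (auto simp: homogeneous_def)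
    then obtain f b where "idempotent R f" "nilpotent R b" "?x = f \<oplus>\<^bsub>R\<^esub> b" "f \<otimes>\<^bsub>R\<^esub> b = b \<otimes>\<^bsub>R\<^esub> f"
      using clean unfolding graded_strongly_nil_clean_def graded_strongly_nil_clean_elem_def by blast
    then have "nilpotent R (?x \<otimes>\<^bsub>R\<^esub> (\<one>\<^bsub>R\<^esub> \<ominus>\<^bsub>R\<^esub> ?x))"
      using R.nilpotent_if_idempotent_plus_nilpotent by blast
    moreover have "(\<one>\<^bsub>?T\<^esub> \<ominus>\<^bsub>?T\<^esub> M) $$ (i, i) = \<one>\<^bsub>R\<^esub> \<ominus>\<^bsub>R\<^esub> ?x"
      using i R.triangular_uminus_entry[OF MT i i]
      by (simp add: a_minus_def triangular_ring_simps matrix_ring_simps)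
    ultimately show ?thesis
      using R.triangular_diag_mult[OF MT _ i, of "\<one>\<^bsub>?T\<^esub> \<ominus>\<^bsub>?T\<^esub> M"] MT by simp
  qed
  then have "nilpotent ?T ?D"
    using R.nilpotent_triangular_iff[of ?D n] MT by simp
  from T.strongly_nil_clean_within[OF S unit_component_mult_closed[OF \<sigma>] M this]
  show ?thesis
    unfolding graded_strongly_nil_clean_elem_def homogeneous_def by blast
qed

lemma graded_nil_clean_if_strongly:
  "graded_strongly_nil_clean G R A \<Longrightarrow> graded_nil_clean G R A"
  unfolding graded_strongly_nil_clean_def graded_nil_clean_def
    graded_strongly_nil_clean_elem_def graded_nil_clean_elem_def by blast

lemma graded_nil_clean_triangular:
  assumes clean: "graded_nil_clean G R A" and \<sigma>: "\<sigma> \<in> {..<n} \<rightarrow>\<^sub>E carrier G"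
  shows "graded_nil_clean G (triangular_ring R n) (triangular_component G R A n \<sigma>)"
proof -
  have "graded_nil_clean_elem G (triangular_ring R n) (triangular_component G R A n \<sigma>) M"
    if M: "M \<in> triangular_component G R A n \<sigma> d" and d: "d \<in> carrier G" for M d
  proof (cases "d = \<one>\<^bsub>G\<^esub>")
    case True
    then show ?thesis
      using triangular_unit_degree_nil_clean[OF clean, of n \<sigma> M] \<sigma> M by auto
  next
    case False
    then show ?thesis
      using triangular_off_unit_degree[OF clean, of n \<sigma> M d] \<sigma> M d
      unfolding graded_strongly_nil_clean_elem_def graded_nil_clean_elem_def by blast
  qed
  then show ?thesis
    by (auto simp: graded_nil_clean_def homogeneous_def)
qed

lemma graded_strongly_nil_clean_triangular:
  assumes clean: "graded_strongly_nil_clean G R A" and \<sigma>: "\<sigma> \<in> {..<n} \<rightarrow>\<^sub>E carrier G"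
  shows "graded_strongly_nil_clean G (triangular_ring R n) (triangular_component G R A n \<sigma>)"
proof -
  have "graded_strongly_nil_clean_elem G (triangular_ring R n) (triangular_component G R A n \<sigma>) M"
    if M: "M \<in> triangular_component G R A n \<sigma> d" and d: "d \<in> carrier G" for M d
  proof (cases "d = \<one>\<^bsub>G\<^esub>")
    case True
    then show ?thesis
      using triangular_unit_degree_strongly_nil_clean[OF clean, of n \<sigma> M] \<sigma> M by auto
  next
    case False
    then show ?thesis
      using triangular_off_unit_degree[OF graded_nil_clean_if_strongly[OF clean], of n \<sigma> M d] \<sigma> M d
      by auto
  qed
  then show ?thesis
    by (auto simp: graded_strongly_nil_clean_def homogeneous_def)
qed

section \<open>From triangular matrices back to the ring\<close>

lemma constant_degrees_corner:
  assumes n: "n \<ge> 1" and \<sigma>: "\<sigma> = (\<lambda>i\<in>{..<n}. \<one>\<^bsub>G\<^esub>)" and x: "x \<in> homogeneous G A"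
  shows "\<exists>M\<in>homogeneous G (triangular_component G R A n \<sigma>). M $$ (0, 0) = x"
proof -
  obtain g where g: "g \<in> carrier G" "x \<in> A g"
    using x by (auto simp: homogeneous_def)
  let ?M = "mat n n (\<lambda>(i, j). if i = 0 \<and> j = 0 then x else \<zero>\<^bsub>R\<^esub>)"
  have "?M \<in> triangular_component G R A n \<sigma> g"
    using g zero_in_component component_subset
    by (auto simp: triangular_component_iff triangular_ring_simps matrix_ring_simps \<sigma>)
  then show ?thesis
    using g n by (intro bexI[of _ ?M]) (auto simp: homogeneous_def)
qed

lemma corner_homogeneous:
  assumes n: "n \<ge> 1" and \<sigma>: "\<sigma> = (\<lambda>i\<in>{..<n}. \<one>\<^bsub>G\<^esub>)"
    and M: "M \<in> homogeneous G (triangular_component G R A n \<sigma>)"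
  shows "M $$ (0, 0) \<in> homogeneous G A"
proof -
  obtain d where d: "d \<in> carrier G" "M \<in> triangular_component G R A n \<sigma> d"
    using M by (auto simp: homogeneous_def)
  then show ?thesis
    using triangular_diag_degree[OF d(2), of 0] n by (auto simp: \<sigma> homogeneous_def)
qed

lemma graded_nil_clean_corner:
  assumes n: "n \<ge> 1" and \<sigma>: "\<sigma> = (\<lambda>i\<in>{..<n}. \<one>\<^bsub>G\<^esub>)"
    and clean: "graded_nil_clean G (triangular_ring R n) (triangular_component G R A n \<sigma>)"
  shows "graded_nil_clean G R A"
  unfolding graded_nil_clean_def graded_nil_clean_elem_def
proof
  fix x assume "x \<in> homogeneous G A"
  then obtain M where "M \<in> homogeneous G (triangular_component G R A n \<sigma>)" and x: "M $$ (0, 0) = x"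
    using constant_degrees_corner[OF n \<sigma>] by blast
  then obtain F B where F: "F \<in> homogeneous G (triangular_component G R A n \<sigma>)"
      "idempotent (triangular_ring R n) F"
    and B: "B \<in> homogeneous G (triangular_component G R A n \<sigma>)" "nilpotent (triangular_ring R n) B"
    and M: "M = F \<oplus>\<^bsub>triangular_ring R n\<^esub> B"
    using clean unfolding graded_nil_clean_def graded_nil_clean_elem_def by blast
  have "idempotent R (F $$ (0, 0))"
    using R.idempotent_diag[OF F(2), of 0] n by simp
  moreover have "nilpotent R (B $$ (0, 0))"
    using R.nilpotent_triangular_iff[of B n] B(2) n by (simp add: nilpotent_def)
  moreover have "x = F $$ (0, 0) \<oplus>\<^bsub>R\<^esub> B $$ (0, 0)"
    using n x by (simp add: M triangular_ring_simps matrix_ring_simps)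
  ultimately show "\<exists>f\<in>homogeneous G A. \<exists>b\<in>homogeneous G A.
      idempotent R f \<and> nilpotent R b \<and> x = f \<oplus>\<^bsub>R\<^esub> b"
    using corner_homogeneous[OF n \<sigma>] F(1) B(1) by blast
qed

lemma graded_strongly_nil_clean_corner:
  assumes n: "n \<ge> 1" and \<sigma>: "\<sigma> = (\<lambda>i\<in>{..<n}. \<one>\<^bsub>G\<^esub>)"
    and clean: "graded_strongly_nil_clean G (triangular_ring R n) (triangular_component G R A n \<sigma>)"
  shows "graded_strongly_nil_clean G R A"
  unfolding graded_strongly_nil_clean_def graded_strongly_nil_clean_elem_def
proof
  fix x assume "x \<in> homogeneous G A"
  then obtain M where "M \<in> homogeneous G (triangular_component G R A n \<sigma>)" and x: "M $$ (0, 0) = x"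
    using constant_degrees_corner[OF n \<sigma>] by blast
  then obtain F B where F: "F \<in> homogeneous G (triangular_component G R A n \<sigma>)"
      "idempotent (triangular_ring R n) F"
    and B: "B \<in> homogeneous G (triangular_component G R A n \<sigma>)" "nilpotent (triangular_ring R n) B"
    and M: "M = F \<oplus>\<^bsub>triangular_ring R n\<^esub> B"
    and comm: "F \<otimes>\<^bsub>triangular_ring R n\<^esub> B = B \<otimes>\<^bsub>triangular_ring R n\<^esub> F"
    using clean unfolding graded_strongly_nil_clean_def graded_strongly_nil_clean_elem_def by blast
  have FB: "F \<in> carrier (triangular_ring R n)" "B \<in> carrier (triangular_ring R n)"
    using F(2) B(2) by (simp_all add: idempotent_def nilpotent_def)
  have "idempotent R (F $$ (0, 0))"
    using R.idempotent_diag[OF F(2), of 0] n by simp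
  moreover have "nilpotent R (B $$ (0, 0))"
    using R.nilpotent_triangular_iff[of B n] B(2) FB n by simp
  moreover have "x = F $$ (0, 0) \<oplus>\<^bsub>R\<^esub> B $$ (0, 0)"
    using n x by (simp add: M triangular_ring_simps matrix_ring_simps)
  moreover have "F $$ (0, 0) \<otimes>\<^bsub>R\<^esub> B $$ (0, 0) = B $$ (0, 0) \<otimes>\<^bsub>R\<^esub> F $$ (0, 0)"
    using R.triangular_diag_mult[OF FB, of 0] R.triangular_diag_mult[OF FB(2,1), of 0] comm n
    by simp
  ultimately show "\<exists>f\<in>homogeneous G A. \<exists>b\<in>homogeneous G A.
      idempotent R f \<and> nilpotent R b \<and> x = f \<oplus>\<^bsub>R\<^esub> b \<and> f \<otimes>\<^bsub>R\<^esub> b = b \<otimes>\<^bsub>R\<^esub> f"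
    using corner_homogeneous[OF n \<sigma>] F(1) B(1) by blast
qed

end

theorem theorem3p20:
  fixes G :: "('g, 'm) monoid_scheme" and R :: "('r, 'k) ring_scheme"
    and A :: "'g \<Rightarrow> 'r set" and n :: nat
  assumes "graded_ring G R A" and "n \<ge> 1"
  shows "(graded_nil_clean G R A \<longleftrightarrow>
      (\<forall>\<sigma> \<in> {..<n} \<rightarrow>\<^sub>E carrier G.
        graded_nil_clean G (triangular_ring R n) (triangular_component G R A n \<sigma>)))
    \<and> (graded_strongly_nil_clean G R A \<longleftrightarrow>
      (\<forall>\<sigma> \<in> {..<n} \<rightarrow>\<^sub>E carrier G.
        graded_strongly_nil_clean G (triangular_ring R n) (triangular_component G R A n \<sigma>)))"
proof -
  interpret graded_ring G R A by fact
  define \<sigma> where "\<sigma> = (\<lambda>i\<in>{..<n}. \<one>\<^bsub>G\<^esub>)"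
  have "\<sigma> \<in> {..<n} \<rightarrow>\<^sub>E carrier G"
    by (simp add: \<sigma>_def)
  then show ?thesis
    using graded_nil_clean_triangular graded_strongly_nil_clean_triangular
      graded_nil_clean_corner[OF assms(2) \<sigma>_def] graded_strongly_nil_clean_corner[OF assms(2) \<sigma>_def]
    by blast
qed

end
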